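(* Let $\alpha\in(0,1)$ be irrational, let $s_\alpha$ be a Sturmian word of angle $\alpha$ and let $m$ be a positive integer. Then, for every integer $k\geq 2$, $s_\alpha$ contains an abelian power of period $m$ and exponent $k$ if and only if $\|m\alpha\|<\frac1k$. In particular, the maximum exponent $k_m$ of an abelian power of period $m$ in $s_\alpha$ is the largest integer $k$ such that $\|m\alpha\|<\frac1k$, i.e. $$k_m=\left\lfloor\frac{1}{\|m\alpha\|}\right\rfloor.$$
   Context: $\{x\}=x-\lfloor x\rfloor$ is the fractional part and $\|x\|=\min(\{x\},1-\{x\})$ is the distance from $x$ to the nearest integer. For irrational $\alpha\in(0,1)$ and $\rho\in[0,1)$, a Sturmian word of angle $\alpha$ and initial point $\rho$ is the infinite word $a_0a_1a_2\cdots$ over $\{a,b\}$ with $a_n=b$ if $\{\rho+n\alpha\}\in I_b$ and $a_n=a$ if $\{\rho+n\alpha\}\in I_a$, where either $I_b=[0,1-\alpha)$, $I_a=[1-\alpha,1)$, or $I_b=(0,1-\alpha]$, $I_a=(1-\alpha,1]$ with the point $0$ identified with $1$. $s_\alpha$ denotes any Sturmian word of angle $\alpha$ (with any initial point and either choice of intervals). The Parikh vector of a word over $\{a,b\}$ is the pair (number of $a$'s, number of $b$'s). A word $w$ is an abelian power of period $m$ and exponent $k$ if $w=u_1u_2\cdots u_k$ with $|u_1|=\dots=|u_k|=m$ and all $u_i$ having the same Parikh vector. A word contains $w$ if $w$ is a factor (contiguous subword) of it. *)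

theory Defs
  imports Complex_Main "HOL-Library.Omega_Words_Fun"
begin

definition int_dist :: "real \<Rightarrow> real" where
  "int_dist x = min (frac x) (1 - frac x)"

datatype letter = La | Lb

definition coding :: "(nat \<Rightarrow> real) \<Rightarrow> real set \<Rightarrow> real set \<Rightarrow> letter word \<Rightarrow> bool" where
  "coding p Ia Ib s \<longleftrightarrow> (\<forall>n. (p n \<in> Ib \<longrightarrow> s n = Lb) \<and> (p n \<in> Ia \<longrightarrow> s n = La))"

text \<open>The fractional part with values in \<open>(0, 1]\<close>: the point 0 of the circle is
  represented by 1.\<close>

definition frac1 :: "real \<Rightarrow> real" where
  "frac1 x = (if frac x = 0 then 1 else frac x)"

text \<open>The intervals cover \<open>[0, 1)\<close>, respectively \<open>(0, 1]\<close>, so for given \<open>\<alpha>\<close> and \<open>\<rho>\<close> each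
  of the two alternatives determines \<open>s\<close>. Irrationality of \<open>\<alpha>\<close> and \<open>0 < \<alpha> < 1\<close> are not
  part of the predicate.\<close>

definition sturmian_word :: "real \<Rightarrow> real \<Rightarrow> letter word \<Rightarrow> bool" where
  "sturmian_word \<alpha> \<rho> s \<longleftrightarrow>
     coding (\<lambda>n. frac (\<rho> + real n * \<alpha>)) {1 - \<alpha>..<1} {0..<1 - \<alpha>} s \<or>
     coding (\<lambda>n. frac1 (\<rho> + real n * \<alpha>)) {1 - \<alpha><..1} {0<..1 - \<alpha>} s"

definition parikh :: "letter list \<Rightarrow> nat \<times> nat" where
  "parikh w = (count_list w La, count_list w Lb)"

definition abelian_power :: "nat \<Rightarrow> nat \<Rightarrow> letter list \<Rightarrow> bool" where
  "abelian_power m k w \<longleftrightarrow>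
     (\<exists>us. w = concat us \<and> length us = k \<and> (\<forall>u\<in>set us. length u = m) \<and>
           (\<forall>u\<in>set us. \<forall>v\<in>set us. parikh u = parikh v))"

definition factor :: "'a list \<Rightarrow> 'a word \<Rightarrow> bool" where
  "factor w s \<longleftrightarrow> (\<exists>i j. i \<le> j \<and> w = s [i \<rightarrow> j])"

definition contains_abelian_power :: "letter word \<Rightarrow> nat \<Rightarrow> nat \<Rightarrow> bool" where
  "contains_abelian_power s m k \<longleftrightarrow> (\<exists>w. factor w s \<and> abelian_power m k w)"

definition is_largest :: "('a::linorder \<Rightarrow> bool) \<Rightarrow> 'a \<Rightarrow> bool" where
  "is_largest P x \<longleftrightarrow> P x \<and> (\<forall>y. P y \<longrightarrow> y \<le> x)"

end

theory Submission
  imports Defs "HOL-Analysis.Kronecker_Approximation_Theorem"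
begin

text \<open>The \<open>n\<close>-th letter is \<open>a\<close> exactly when \<open>F (\<rho> + n\<alpha>)\<close> jumps by one at the next step, where \<open>F\<close>
  is the floor or the ceiling, depending on the choice of intervals. Hence the number of \<open>a\<close>'s in a
  factor is a difference of two values of \<open>F\<close>. Consecutive blocks of length \<open>m\<close>, each with \<open>c\<close>
  letters \<open>a\<close>, give \<open>\<bar>k c - k m \<alpha>\<bar> < 1\<close>, as \<open>F (y) - F (x)\<close> differs from \<open>y - x\<close> by less than 1.
  Conversely, let \<open>c\<close> be the integer nearest to \<open>m\<alpha>\<close> and \<open>\<delta> = m\<alpha> - c\<close>. If \<open>k \<bar>\<delta>\<bar> < 1\<close>, then by
  density of \<open>\<rho> + i\<alpha>\<close> modulo 1 some \<open>i\<close> makes the points \<open>\<rho> + i\<alpha> + j\<delta>\<close> with \<open>j \<le> k\<close> avoid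
  the integers and lie between two consecutive ones, so that every block contains \<open>c\<close> letters \<open>a\<close>.\<close>

section \<open>Distance to the nearest integer, and density modulo 1\<close>

lemma int_dist_le:
  fixes c :: int
  shows "int_dist x \<le> \<bar>x - c\<bar>"
proof -
  have "c \<le> \<lfloor>x\<rfloor> \<or> \<lfloor>x\<rfloor> + 1 \<le> c" by linarith
  then have "real_of_int c \<le> real_of_int \<lfloor>x\<rfloor> \<or> real_of_int \<lfloor>x\<rfloor> + 1 \<le> real_of_int c"
    by (metis of_int_1 of_int_add of_int_le_iff)
  then show ?thesis unfolding int_dist_def frac_def by linarith
qed

lemma int_dist_attained:
  obtains c :: int where "int_dist x = \<bar>x - c\<bar>"
proof (cases "frac x \<le> 1 - frac x")
  case True
  then have "int_dist x = \<bar>x - \<lfloor>x\<rfloor>\<bar>"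
    using frac_ge_0[of x] by (simp add: int_dist_def frac_def)
  then show ?thesis by (rule that)
next
  case False
  then have "int_dist x = \<bar>x - (\<lfloor>x\<rfloor> + 1 :: int)\<bar>"
    using frac_lt_1[of x] by (simp add: int_dist_def frac_def)
  then show ?thesis by (rule that)
qed

lemma int_dist_le_half: "int_dist x \<le> 1 / 2"
  unfolding int_dist_def by linarith

lemma int_dist_pos:
  assumes "x \<notin> \<int>"
  shows "0 < int_dist x"
  using assms frac_lt_1[of x] by (simp add: int_dist_def frac_gt_0_iff)

lemma real_irrational_translate_dense:
  fixes \<alpha> u v :: real
  assumes "\<alpha> \<notin> \<rat>" and "u < v"
  obtains i :: nat and h :: int
    where "u < \<rho> + real i * \<alpha> - h" and "\<rho> + real i * \<alpha> - h < v"
proof -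
  \<comment> \<open>Kronecker's theorem is applied to the midpoint of the target interval, shifted
    by \<open>\<rho>\<close>, with half the interval's length as tolerance; \<open>h\<close> then
    collects the two floors, so that the difference of fractional parts becomes the displacement
    from \<open>t\<close>.\<close>
  define t where "t = (u + v) / 2"
  have "0 < (v - u) / 2" using assms by simp
  then obtain i :: nat where i: "\<bar>frac (real i * \<alpha>) - frac (t - \<rho>)\<bar> < (v - u) / 2"
    using Kronecker_approx_1_explicit[OF assms(1), of "frac (t - \<rho>)"]
    by (metis frac_ge_0 frac_lt_1 less_imp_le)
  define h where "h = \<lfloor>real i * \<alpha>\<rfloor> - \<lfloor>t - \<rho>\<rfloor>"
  have "frac (real i * \<alpha>) - frac (t - \<rho>) = \<rho> + real i * \<alpha> - h - t"
    by (simp add: frac_def h_def)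
  with i have "\<bar>\<rho> + real i * \<alpha> - h - t\<bar> < (v - u) / 2" by simp
  then have "u < \<rho> + real i * \<alpha> - h" "\<rho> + real i * \<alpha> - h < v"
    by (simp_all add: t_def abs_less_iff field_simps)
  then show ?thesis by (rule that)
qed

section \<open>Rotation steps and letter counts\<close>

lemma floor_add_step:
  fixes x \<alpha> :: real
  assumes "0 < \<alpha>" "\<alpha> < 1"
  shows "\<lfloor>x + \<alpha>\<rfloor> = \<lfloor>x\<rfloor> + (if 1 - \<alpha> \<le> frac x then 1 else 0)"
  using assms unfolding frac_def by (auto intro!: floor_unique) linarith+

lemma ceiling_add_step:
  fixes x \<alpha> :: real
  assumes "0 < \<alpha>" "\<alpha> < 1"
  shows "\<lceil>x + \<alpha>\<rceil> = \<lceil>x\<rceil> + (if 1 - \<alpha> < frac1 x then 1 else 0)"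
proof -
  \<comment> \<open>\<open>frac1\<close> measures from the largest integer strictly below
    \<open>x\<close>, which makes it the ceiling counterpart of \<open>frac\<close>.\<close>
  have "frac1 x = x - \<lceil>x\<rceil> + 1"
  proof (cases "x \<in> \<int>")
    case True
    then show ?thesis by (auto simp: frac1_def elim: Ints_cases)
  next
    case False
    then have "\<lceil>x\<rceil> = \<lfloor>x\<rfloor> + 1"
      by (metis Ints_of_int ceiling_altdef)
    with False show ?thesis by (simp add: frac1_def) (simp add: frac_def)
  qed
  then show ?thesis
    using assms by (auto intro!: ceiling_unique) linarith+
qed

text \<open>Hiding floor and ceiling behind one \<open>F\<close> lets both interval conventions
  share the later arguments. The one-letter increments of \<open>F\<close> telescope along the
  factor.\<close>

lemma sturmian_count:
  assumes "0 < \<alpha>" "\<alpha> < 1" "sturmian_word \<alpha> \<rho> s"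
  obtains F :: "real \<Rightarrow> int" where "F = floor \<or> F = ceiling"
    and "\<And>i n. int (count_list (s [i \<rightarrow> i + n]) La)
                = F (\<rho> + real (i + n) * \<alpha>) - F (\<rho> + real i * \<alpha>)"
proof -
  have "\<exists>F :: real \<Rightarrow> int. (F = floor \<or> F = ceiling) \<and>
          (\<forall>n. F (\<rho> + real n * \<alpha> + \<alpha>) = F (\<rho> + real n * \<alpha>) + (if s n = La then 1 else 0))"
    using assms(3) unfolding sturmian_word_def
  proof
    assume c: "coding (\<lambda>n. frac (\<rho> + real n * \<alpha>)) {1 - \<alpha>..<1} {0..<1 - \<alpha>} s"
    \<comment> \<open>\<open>coding\<close> gives implications only; the equivalence holds because
      the two intervals exhaust the range of \<open>frac\<close>.\<close>
    have "s n = La \<longleftrightarrow> 1 - \<alpha> \<le> frac (\<rho> + real n * \<alpha>)" for n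
      using c frac_ge_0[of "\<rho> + real n * \<alpha>"] frac_lt_1[of "\<rho> + real n * \<alpha>"]
      unfolding coding_def by (metis atLeastLessThan_iff letter.distinct(1) not_le)
    then show ?thesis
      using floor_add_step[OF assms(1,2)] by (intro exI[of _ floor]) simp
  next
    assume c: "coding (\<lambda>n. frac1 (\<rho> + real n * \<alpha>)) {1 - \<alpha><..1} {0<..1 - \<alpha>} s"
    have "0 < frac1 x \<and> frac1 x \<le> 1" for x
      using frac_ge_0[of x] frac_lt_1[of x] by (auto simp: frac1_def)
    with c have "s n = La \<longleftrightarrow> 1 - \<alpha> < frac1 (\<rho> + real n * \<alpha>)" for n
      unfolding coding_def by (metis greaterThanAtMost_iff letter.distinct(1) not_le)
    then show ?thesis
      using ceiling_add_step[OF assms(1,2)] by (intro exI[of _ ceiling]) simp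
  qed
  then obtain F :: "real \<Rightarrow> int" where F: "F = floor \<or> F = ceiling"
    and step: "\<And>n. F (\<rho> + real n * \<alpha> + \<alpha>) = F (\<rho> + real n * \<alpha>) + (if s n = La then 1 else 0)"
    by blast
  have "int (count_list (s [i \<rightarrow> i + n]) La)
          = F (\<rho> + real (i + n) * \<alpha>) - F (\<rho> + real i * \<alpha>)" for i n
  proof (induction n)
    case 0
    then show ?case by simp
  next
    case (Suc n)
    have "F (\<rho> + real (i + Suc n) * \<alpha>)
            = F (\<rho> + real (i + n) * \<alpha>) + (if s (i + n) = La then 1 else 0)"
      using step[of "i + n"] by (simp add: algebra_simps)
    with Suc show ?case by simp
  qed
  with F show ?thesis by (rule that)
qed

section \<open>Abelian powers as runs of consecutive blocks\<close>

lemma concat_blocks: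
  "concat (map (\<lambda>j. s [i + j * m \<rightarrow> i + j * m + m]) [0..<k]) = s [i \<rightarrow> i + k * m]"
proof (induction k)
  case 0
  then show ?case by simp
next
  case (Suc k)
  have "s [i \<rightarrow> i + k * m] @ s [i + k * m \<rightarrow> i + k * m + m] = s [i \<rightarrow> i + k * m + m]"
    unfolding subsequence_def map_append[symmetric]
    by (subst upt_add_eq_append[symmetric]) simp_all
  with Suc show ?case by (simp add: algebra_simps)
qed

lemma parikh_eq_iff:
  assumes "length u = length v"
  shows "parikh u = parikh v \<longleftrightarrow> count_list u La = count_list v La"
proof -
  have "count_list w La + count_list w Lb = length w" for w
  proof (induction w)
    case (Cons x w)
    then show ?case by (cases x) auto
  qed simp
  from this[of u] this[of v] assms show ?thesis by (auto simp: parikh_def)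
qed

text \<open>Since all blocks have length \<open>m\<close>, the number of a's fixes the Parikh
  vector, so \<open>sturmian_count\<close> suffices to decide the property.\<close>

lemma contains_abelian_power_iff:
  "contains_abelian_power s m k \<longleftrightarrow>
     (\<exists>i c. \<forall>j<k. count_list (s [i + j * m \<rightarrow> i + j * m + m]) La = c)"
proof
  assume "contains_abelian_power s m k"
  then obtain i i' us where "i \<le> i'" and us: "s [i \<rightarrow> i'] = concat us" "length us = k"
    and len: "\<And>u. u \<in> set us \<Longrightarrow> length u = m"
    and par: "\<And>u v. u \<in> set us \<Longrightarrow> v \<in> set us \<Longrightarrow> parikh u = parikh v"
    unfolding contains_abelian_power_def factor_def abelian_power_def by blast
  have "map length us = replicate k m"
    using len us(2) by (simp add: list_eq_iff_nth_eq)
  then have "length (concat us) = k * m"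
    by (simp add: length_concat sum_list_replicate)
  then have "i' - i = k * m" by (simp flip: us(1))
  with \<open>i \<le> i'\<close> have i': "i' = i + k * m" by simp
  \<comment> \<open>A word has only one decomposition into \<open>k\<close> blocks of length
    \<open>m\<close>.\<close>
  have "us = map (\<lambda>j. s [i + j * m \<rightarrow> i + j * m + m]) [0..<k]"
  proof (rule concat_injective)
    show "concat us = concat (map (\<lambda>j. s [i + j * m \<rightarrow> i + j * m + m]) [0..<k])"
      unfolding concat_blocks us(1)[symmetric] i' ..
  qed (use us(2) len in \<open>auto simp: set_zip\<close>)
  then have "s [i + j * m \<rightarrow> i + j * m + m] \<in> set us" if "j < k" for j
    using that by auto
  moreover have "us ! 0 \<in> set us" if "j < k" for j
    using that us(2) by (intro nth_mem) simp
  ultimately have "parikh (s [i + j * m \<rightarrow> i + j * m + m]) = parikh (us ! 0)" if "j < k" for j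
    using that par by blast
  then have "\<forall>j<k. count_list (s [i + j * m \<rightarrow> i + j * m + m]) La = count_list (us ! 0) La"
    by (simp add: parikh_def)
  then show "\<exists>i c. \<forall>j<k. count_list (s [i + j * m \<rightarrow> i + j * m + m]) La = c" by blast
next
  assume "\<exists>i c. \<forall>j<k. count_list (s [i + j * m \<rightarrow> i + j * m + m]) La = c"
  then obtain i c where c: "\<And>j. j < k \<Longrightarrow> count_list (s [i + j * m \<rightarrow> i + j * m + m]) La = c"
    by blast
  define us where "us = map (\<lambda>j. s [i + j * m \<rightarrow> i + j * m + m]) [0..<k]"
  have "\<forall>u\<in>set us. length u = m" and "\<forall>u\<in>set us. \<forall>v\<in>set us. parikh u = parikh v"
    by (auto simp: us_def parikh_eq_iff c)
  moreover have "concat us = s [i \<rightarrow> i + k * m]" "length us = k"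
    by (simp_all add: us_def concat_blocks)
  ultimately have "abelian_power m k (s [i \<rightarrow> i + k * m])"
    unfolding abelian_power_def by (intro exI[of _ us]) metis
  moreover have "factor (s [i \<rightarrow> i + k * m]) s"
    unfolding factor_def by (intro exI[of _ i] exI[of _ "i + k * m"]) simp
  ultimately show "contains_abelian_power s m k"
    unfolding contains_abelian_power_def by blast
qed

text \<open>Allowing \<open>k = 1\<close>, where both sides hold because \<open>int_dist\<close> is
  at most 1/2, lets the search for the maximum use one criterion for all positive exponents.\<close>

lemma sturmian_abelian_power_iff:
  assumes "0 < \<alpha>" "\<alpha> < 1" "\<alpha> \<notin> \<rat>" "sturmian_word \<alpha> \<rho> s" "k > 0"
  shows "contains_abelian_power s m k \<longleftrightarrow> int_dist (real m * \<alpha>) < 1 / real k"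
proof -
  obtain F :: "real \<Rightarrow> int" where F: "F = floor \<or> F = ceiling"
    and count: "\<And>i n. int (count_list (s [i \<rightarrow> i + n]) La)
                = F (\<rho> + real (i + n) * \<alpha>) - F (\<rho> + real i * \<alpha>)"
    using sturmian_count[OF assms(1,2,4)] by blast
  show ?thesis
  proof
    assume "contains_abelian_power s m k"
    then obtain i c where c: "\<And>j. j < k \<Longrightarrow> count_list (s [i + j * m \<rightarrow> i + j * m + m]) La = c"
      unfolding contains_abelian_power_iff by blast
    have sum: "F (\<rho> + real (i + j * m) * \<alpha>) - F (\<rho> + real i * \<alpha>) = int j * int c" if "j \<le> k" for j
      using that
    proof (induction j)
      case 0
      then show ?case by simp
    next
      case (Suc j)
      have "F (\<rho> + real (i + j * m + m) * \<alpha>) - F (\<rho> + real (i + j * m) * \<alpha>) = int c"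
        using count[of "i + j * m" m] c[of j] Suc.prems by simp
      moreover have "i + Suc j * m = i + j * m + m" by simp
      ultimately show ?case using Suc by (simp only: of_nat_Suc) (simp add: algebra_simps)
    qed
    \<comment> \<open>The values \<open>F x - x\<close> lie in a half-open interval of length 1:
      (-1, 0] for floor, [0, 1) for ceiling.\<close>
    have "\<bar>real_of_int (F y - F x) - (y - x)\<bar> < 1" for x y
      using F by (elim disjE; simp) linarith+
    from this[of "\<rho> + real (i + k * m) * \<alpha>" "\<rho> + real i * \<alpha>"]
    have "\<bar>real k * c - real (k * m) * \<alpha>\<bar> < 1"
      using sum[of k] by (simp add: algebra_simps)
    then have "real k * \<bar>real m * \<alpha> - c\<bar> < 1"
      by (simp add: abs_mult_pos' algebra_simps abs_minus_commute)
    then have "\<bar>real m * \<alpha> - c\<bar> < 1 / real k"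
      using assms(5) by (simp add: field_simps)
    with int_dist_le[of "real m * \<alpha>" "int c"] show "int_dist (real m * \<alpha>) < 1 / real k"
      by simp
  next
    assume d: "int_dist (real m * \<alpha>) < 1 / real k"
    obtain c :: int where c: "int_dist (real m * \<alpha>) = \<bar>real m * \<alpha> - c\<bar>"
      by (rule int_dist_attained)
    define \<delta> where "\<delta> = real m * \<alpha> - c"
    have kd: "real k * \<bar>\<delta>\<bar> < 1"
      using d c assms(5) by (simp add: \<delta>_def field_simps)
    \<comment> \<open>For a starting point x, the condition u < x < v says exactly that both x and x
      + k\<delta> lie in (0, 1). The points x + j\<delta> in between then do so too.\<close>
    define u where "u = max 0 (- (real k * \<delta>))"
    define v where "v = min 1 (1 - real k * \<delta>)"
    have "\<bar>real k * \<delta>\<bar> < 1" using kd by (simp add: abs_mult)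
    then have "u < v" by (simp add: u_def v_def abs_less_iff)
    then obtain i :: nat and h :: int
      where i: "u < \<rho> + real i * \<alpha> - h" "\<rho> + real i * \<alpha> - h < v"
      using real_irrational_translate_dense[OF assms(3)] by metis
    have pos: "0 < \<rho> + real i * \<alpha> - h + real j * \<delta>" "\<rho> + real i * \<alpha> - h + real j * \<delta> < 1"
      if "j \<le> k" for j
    proof -
      have "min 0 (real k * \<delta>) \<le> real j * \<delta> \<and> real j * \<delta> \<le> max 0 (real k * \<delta>)"
      proof (cases "0 \<le> \<delta>")
        case True
        with that have "0 \<le> real j * \<delta>" "real j * \<delta> \<le> real k * \<delta>"
          by (simp_all add: mult_right_mono)
        then show ?thesis by linarith
      next
        case False
        with that have "real j * \<delta> \<le> 0" "real k * \<delta> \<le> real j * \<delta>"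
          by (simp_all add: mult_right_mono_neg mult_nonneg_nonpos)
        then show ?thesis by linarith
      qed
      with i show "0 < \<rho> + real i * \<alpha> - h + real j * \<delta>"
        and "\<rho> + real i * \<alpha> - h + real j * \<delta> < 1"
        unfolding u_def v_def by linarith+
    qed
    \<comment> \<open>\<open>F (1 / 2)\<close> names the constant value of \<open>F\<close> on (0,
      1), which is 0 for floor and 1 for ceiling; it cancels in the block counts.\<close>
    have unit: "F (y + of_int z) = z + F (1 / 2)" if "0 < y" "y < 1" for y z
      using F
    proof
      assume "F = floor"
      moreover have "\<lfloor>y\<rfloor> = 0" using that by (simp add: floor_eq_iff)
      ultimately show ?thesis by simp
    next
      assume "F = ceiling"
      moreover have "\<lceil>y\<rceil> = 1" using that by (simp add: ceiling_eq_iff)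
      moreover have "\<lceil>1 / 2 :: real\<rceil> = 1" by (simp add: ceiling_eq_iff)
      ultimately show ?thesis by simp
    qed
    have val: "F (\<rho> + real (i + j * m) * \<alpha>) = h + int j * c + F (1 / 2)" if "j \<le> k" for j
    proof -
      have "\<rho> + real (i + j * m) * \<alpha> = \<rho> + real i * \<alpha> - h + real j * \<delta> + of_int (h + int j * c)"
        by (simp add: \<delta>_def algebra_simps)
      then show ?thesis by (simp only: unit pos that)
    qed
    have "int (count_list (s [i + j * m \<rightarrow> i + j * m + m]) La) = c" if "j < k" for j
    proof -
      have eq: "i + j * m + m = i + Suc j * m" by simp
      have "int (count_list (s [i + j * m \<rightarrow> i + j * m + m]) La)
              = (h + int (Suc j) * c + F (1 / 2)) - (h + int j * c + F (1 / 2))"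
        unfolding count unfolding eq by (simp only: val that less_imp_le Suc_leI)
      then show ?thesis by (simp add: algebra_simps)
    qed
    then have "\<forall>j<k. count_list (s [i + j * m \<rightarrow> i + j * m + m]) La = nat c"
      by (metis nat_int)
    then show "contains_abelian_power s m k"
      unfolding contains_abelian_power_iff by blast
  qed
qed

theorem theorem4p7:
  fixes \<alpha> \<rho> :: real and s :: "letter word" and m :: nat
  assumes "0 < \<alpha>" and "\<alpha> < 1" and "\<alpha> \<notin> \<rat>"
    and "0 \<le> \<rho>" and "\<rho> < 1"
    and "sturmian_word \<alpha> \<rho> s"
    and "m > 0"
  shows "(\<forall>k::nat. k \<ge> 2 \<longrightarrow>
            (contains_abelian_power s m k \<longleftrightarrow> int_dist (real m * \<alpha>) < 1 / real k)) \<and>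
         (\<exists>km::nat.
            is_largest (\<lambda>k. contains_abelian_power s m k) km \<and>
            is_largest (\<lambda>k::int. int_dist (real m * \<alpha>) < 1 / real_of_int k) (int km) \<and>
            int km = \<lfloor>1 / int_dist (real m * \<alpha>)\<rfloor>)"
proof -
  define d where "d = int_dist (real m * \<alpha>)"
  have irr: "real m * \<alpha> \<notin> \<rat>"
    using assms(3,7) Rats_divide[of "real m * \<alpha>" "real m"] by auto
  then have "0 < d"
    unfolding d_def using Ints_subset_Rats by (intro int_dist_pos) blast
  have "d \<le> 1 / 2" unfolding d_def by (rule int_dist_le_half)
  have iff: "contains_abelian_power s m k \<longleftrightarrow> d < 1 / real k" if "k > 0" for k
    using sturmian_abelian_power_iff[OF assms(1-3,6) that] by (simp add: d_def)
  \<comment> \<open>\<open>d\<close> is irrational, being the distance from an irrational number to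
    an integer. This is what turns the strict bound d < 1/k into k \<le>
    \<open>\<lfloor>1 / d\<rfloor>\<close>.\<close>
  have "1 / d \<notin> \<int>"
  proof
    assume "1 / d \<in> \<int>"
    then have "1 / d \<in> \<rat>" using Ints_subset_Rats by blast
    then have "1 / (1 / d) \<in> \<rat>" by (rule Rats_divide[OF Rats_1])
    moreover obtain c :: int where "d = \<bar>real m * \<alpha> - c\<bar>"
      unfolding d_def by (rule int_dist_attained)
    ultimately have "real m * \<alpha> - c \<in> \<rat>"
      by (simp add: Rats_abs_iff)
    then have "real m * \<alpha> - c + c \<in> \<rat>"
      by (intro Rats_add) auto
    with irr show False by simp
  qed
  have lt_iff: "d < 1 / real_of_int k \<longleftrightarrow> k \<le> \<lfloor>1 / d\<rfloor>" if "k > 0" for k :: int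
  proof -
    have "d < 1 / real_of_int k \<longleftrightarrow> real_of_int k < 1 / d"
      using that \<open>0 < d\<close> by (simp add: field_simps)
    also have "\<dots> \<longleftrightarrow> real_of_int k \<le> 1 / d"
      using \<open>1 / d \<notin> \<int>\<close> by (metis Ints_of_int less_le)
    finally show ?thesis by (simp add: le_floor_iff)
  qed
  define km where "km = nat \<lfloor>1 / d\<rfloor>"
  have "1 \<le> 1 / d"
    using \<open>0 < d\<close> \<open>d \<le> 1 / 2\<close> by (simp add: field_simps)
  then have "1 \<le> \<lfloor>1 / d\<rfloor>" by simp
  then have km: "int km = \<lfloor>1 / d\<rfloor>" "km > 0" by (auto simp: km_def)
  have iff_km: "contains_abelian_power s m k \<longleftrightarrow> k \<le> km" if "k > 0" for k
    using iff[OF that] lt_iff[of "int k"] that by (simp flip: km(1))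
  \<comment> \<open>Exponent 0 lies outside \<open>iff_km\<close>, but it is trivially at most
    \<open>km\<close>.\<close>
  have "is_largest (\<lambda>k. contains_abelian_power s m k) km"
    unfolding is_largest_def using iff_km km by (metis le0 neq0_conv order_refl)
  moreover have "is_largest (\<lambda>k::int. d < 1 / real_of_int k) (int km)"
    unfolding is_largest_def
  proof (intro conjI allI impI)
    show "d < 1 / real_of_int (int km)"
      using lt_iff[of "int km"] km(2) by (simp flip: km(1))
  next
    fix k :: int
    assume "d < 1 / real_of_int k"
    \<comment> \<open>Integers k \<le> 0 are excluded here, including k = 0, where division by zero
      gives 0.\<close>
    moreover from this have "0 < 1 / real_of_int k" using \<open>0 < d\<close> by linarith
    ultimately show "k \<le> int km" using lt_iff[of k] by (simp add: km(1))
  qed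
  moreover have "\<forall>k\<ge>2. contains_abelian_power s m k \<longleftrightarrow> d < 1 / real k"
    using iff by simp
  ultimately show ?thesis
    using km(1) unfolding d_def by blast
qed

end
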